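(* Fix $p\in(0,1)$. Then the probability that Maker has a winning strategy in the (unbiased, Maker moving first) Maker--Breaker directed triangle game played on the random tournament $T(n,p)$ tends to $1$ as $n\to\infty$.
   Context: Let $V_n=\{1,2,\ldots,n\}$, and let $(i,j)$ denote the directed edge from $i$ to $j$. A tournament on $V_n$ is a directed graph containing, for all distinct $i,j\in V_n$, precisely one of $(i,j)$ and $(j,i)$, with no loops or parallel edges. Random tournament $T(n,p)$: the tournament on $V_n$ obtained by independently orienting, for each pair $i<j$, the edge between $i$ and $j$ from $i$ to $j$ with probability $p$, and from $j$ to $i$ with probability $1-p$. A directed triangle $(i,j,k)$ in a tournament $T$ consists of three distinct vertices $i,j,k$ with $(i,j),(j,k),(k,i)\in E(T)$. Maker--Breaker directed triangle game on a tournament $T$: the board is the edge set $E(T)$ (with $T$ known to both players before the game starts). Maker moves first; the two players alternate, Maker claiming one previously untaken edge in each of her turns and Breaker claiming (deleting) one previously untaken edge in each of hers, until all edges are exhausted. Maker wins if at the end she has claimed all three edges of some directed triangle of $T$; otherwise Breaker wins. *)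

theory Defs
  imports "HOL-Probability.Probability"
begin

section \<open>Tournaments and random tournaments\<close>

text \<open>A directed graph on a vertex set is given by its set of edges; the pair \<open>(i, j)\<close> is the
  edge directed from \<open>i\<close> to \<open>j\<close>.\<close>

definition tournament_on :: "'a set \<Rightarrow> ('a \<times> 'a) set \<Rightarrow> bool" where
  "tournament_on V E \<longleftrightarrow>
     E \<subseteq> V \<times> V \<and> irrefl E \<and>
     (\<forall>i\<in>V. \<forall>j\<in>V. i \<noteq> j \<longrightarrow> ((i, j) \<in> E) \<noteq> ((j, i) \<in> E))"

definition vertex_pairs :: "nat \<Rightarrow> (nat \<times> nat) set" where
  "vertex_pairs n = {(i, j). 1 \<le> i \<and> i < j \<and> j \<le> n}"

text \<open>The tournament determined by coin flips \<open>f\<close>: for \<open>i < j\<close>, the edge goes from \<open>i\<close> to \<open>j\<close>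
  iff \<open>f (i, j)\<close>.\<close>

definition orient :: "nat \<Rightarrow> (nat \<times> nat \<Rightarrow> bool) \<Rightarrow> (nat \<times> nat) set" where
  "orient n f = {(i, j). (i, j) \<in> vertex_pairs n \<and> f (i, j)} \<union>
                {(j, i). (i, j) \<in> vertex_pairs n \<and> \<not> f (i, j)}"

text \<open>\<open>Pi_pmf\<close> makes the coin flips independent; its argument \<open>False\<close> is only the dummy value
  outside \<open>vertex_pairs n\<close>.\<close>

definition random_tournament :: "nat \<Rightarrow> real \<Rightarrow> (nat \<times> nat) set pmf" where
  "random_tournament n p =
     map_pmf (orient n) (Pi_pmf (vertex_pairs n) False (\<lambda>_. bernoulli_pmf p))"

lemma finite_vertex_pairs: "finite (vertex_pairs n)"
  by (rule finite_subset[of _ "{1..n} \<times> {1..n}"]) (auto simp: vertex_pairs_def)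

lemma tournament_on_orient: "tournament_on {1..n} (orient n f)"
  unfolding tournament_on_def
proof (intro conjI ballI impI)
  show "orient n f \<subseteq> {1..n} \<times> {1..n}" "irrefl (orient n f)"
    by (auto simp: orient_def vertex_pairs_def irrefl_def)
  fix i j :: nat
  assume "i \<in> {1..n}" "j \<in> {1..n}" "i \<noteq> j"
  thus "((i, j) \<in> orient n f) \<noteq> ((j, i) \<in> orient n f)"
    by (cases "i < j") (auto simp: orient_def vertex_pairs_def)
qed

lemma tournament_on_random_tournament:
  assumes "T \<in> set_pmf (random_tournament n p)"
  shows "tournament_on {1..n} T"
  using assms tournament_on_orient by (auto simp: random_tournament_def simp del: One_nat_def)

section \<open>Maker--Breaker games\<close>

text \<open>A game has a finite board \<open>X\<close> and a family \<open>F\<close> of winning sets. A (partial) play is the list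
  of the elements claimed so far, in order; Maker moves first, so she owns the entries at even
  (zero-based) positions, and a play is complete once it exhausts \<open>X\<close>.\<close>

definition partial_play :: "'b set \<Rightarrow> 'b list \<Rightarrow> bool" where
  "partial_play X h \<longleftrightarrow> distinct h \<and> set h \<subseteq> X"

definition maker_claims :: "'b list \<Rightarrow> 'b set" where
  "maker_claims h = {h ! i | i. i < length h \<and> even i}"

text \<open>A strategy for Maker assigns her next move to the history of the play.\<close>

definition follows_strategy :: "('b list \<Rightarrow> 'b) \<Rightarrow> 'b list \<Rightarrow> bool" where
  "follows_strategy \<sigma> h \<longleftrightarrow> (\<forall>i < length h. even i \<longrightarrow> h ! i = \<sigma> (take i h))"

definition legal_maker_strategy :: "'b set \<Rightarrow> ('b list \<Rightarrow> 'b) \<Rightarrow> bool" where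
  "legal_maker_strategy X \<sigma> \<longleftrightarrow>
     (\<forall>h. partial_play X h \<and> follows_strategy \<sigma> h \<and> even (length h) \<and> set h \<noteq> X
          \<longrightarrow> \<sigma> h \<in> X - set h)"

text \<open>Legality is essential: a strategy that proposes illegal moves is followed by no complete
  play, so the second condition alone would hold vacuously for it.\<close>

definition winning_maker_strategy :: "'b set \<Rightarrow> 'b set set \<Rightarrow> ('b list \<Rightarrow> 'b) \<Rightarrow> bool" where
  "winning_maker_strategy X F \<sigma> \<longleftrightarrow>
     legal_maker_strategy X \<sigma> \<and>
     (\<forall>h. partial_play X h \<and> set h = X \<and> follows_strategy \<sigma> h
          \<longrightarrow> (\<exists>W\<in>F. W \<subseteq> maker_claims h))"

definition maker_wins :: "'b set \<Rightarrow> 'b set set \<Rightarrow> bool" where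
  "maker_wins X F \<longleftrightarrow> (\<exists>\<sigma>. winning_maker_strategy X F \<sigma>)"

section \<open>The directed triangle game\<close>

definition directed_triangle :: "('a \<times> 'a) set \<Rightarrow> 'a \<Rightarrow> 'a \<Rightarrow> 'a \<Rightarrow> bool" where
  "directed_triangle T i j k \<longleftrightarrow>
     i \<noteq> j \<and> j \<noteq> k \<and> k \<noteq> i \<and> (i, j) \<in> T \<and> (j, k) \<in> T \<and> (k, i) \<in> T"

definition triangle_edge_sets :: "('a \<times> 'a) set \<Rightarrow> ('a \<times> 'a) set set" where
  "triangle_edge_sets T = {{(i, j), (j, k), (k, i)} | i j k. directed_triangle T i j k}"

definition maker_wins_triangle_game :: "('a \<times> 'a) set \<Rightarrow> bool" where
  "maker_wins_triangle_game T \<longleftrightarrow> maker_wins T (triangle_edge_sets T)"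

end

theory Submission
  imports Defs
begin

text \<open>Suppose \<open>v\<close> is a vertex and \<open>A\<close>, \<open>B\<close> are sets of three vertices each such that all edges
  between them are directed \<open>v \<rightarrow> A \<rightarrow> B \<rightarrow> v\<close>. Maker claims \<open>(v, a)\<close> and then
  \<open>(v, a')\<close> for some \<open>a, a' \<in> A\<close>. Each of Breaker's two replies interferes with at most one
  \<open>b \<in> B\<close>, so Maker can claim \<open>(b, v)\<close> for a third one, and this threatens to close both
  \<open>(v, a, b)\<close> and \<open>(v, a', b)\<close>. A random tournament contains this seven-vertex pattern with
  probability tending to 1, because each of the \<open>n div 7\<close> consecutive blocks of seven vertices
  carries it independently with probability bounded away from 0.\<close>

section \<open>Winning positions\<close>

text \<open>Maker is to move and owns \<open>M\<close>, Breaker owns \<open>B\<close>. The disjunction in \<open>move\<close> prevents the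
  last premise from holding vacuously after a losing move that exhausts the board.\<close>

inductive maker_forces :: "'b set \<Rightarrow> 'b set set \<Rightarrow> 'b set \<Rightarrow> 'b set \<Rightarrow> bool" for X F where
  won: "W \<in> F \<Longrightarrow> W \<subseteq> M \<Longrightarrow> maker_forces X F M B"
| move: "x \<in> X - (M \<union> B) \<Longrightarrow> (\<exists>W\<in>F. W \<subseteq> insert x M) \<or> \<not> X \<subseteq> insert x (M \<union> B) \<Longrightarrow>
    (\<And>y. y \<in> X - insert x (M \<union> B) \<Longrightarrow> maker_forces X F (insert x M) (insert y B)) \<Longrightarrow>
    maker_forces X F M B"

lemma maker_forces_finish:
  assumes "x \<in> X - (M \<union> B)" "W \<in> F" "W \<subseteq> insert x M"
  shows "maker_forces X F M B"
proof (rule move[OF assms(1)])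
  show "(\<exists>W\<in>F. W \<subseteq> insert x M) \<or> \<not> X \<subseteq> insert x (M \<union> B)"
    using assms by blast
qed (rule won[OF assms(2,3)])

lemma maker_claims_snoc:
  "maker_claims (h @ [x]) = (if even (length h) then insert x (maker_claims h) else maker_claims h)"
proof -
  have img: "maker_claims k = (!) k ` {i. i < length k \<and> even i}" for k :: "'a list"
    by (auto simp: maker_claims_def)
  have "{i. i < length (h @ [x]) \<and> even i} =
      (if even (length h) then insert (length h) else id) {i. i < length h \<and> even i}"
    by (auto simp: less_Suc_eq)
  moreover have "(!) (h @ [x]) ` {i. i < length h \<and> even i} = maker_claims h"
    unfolding img by (intro image_cong) (auto simp: nth_append)
  ultimately show ?thesis by (simp add: img[of "h @ [x]"])
qed

lemma maker_claims_subset: "maker_claims h \<subseteq> set h"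
  by (auto simp: maker_claims_def)

lemma follows_strategy_snoc:
  "follows_strategy \<sigma> (h @ [x]) \<longleftrightarrow>
     follows_strategy \<sigma> h \<and> (even (length h) \<longrightarrow> x = \<sigma> h)"
  by (auto simp: follows_strategy_def nth_append less_Suc_eq)

text \<open>\<open>maker_forces\<close> depends only on the two players' sets, a strategy on the
  whole history. Choosing at each history a move that witnesses rule \<open>move\<close> gives
  \<open>\<sigma>\<close>, and an invariant along the play shows that it wins.\<close>

lemma maker_wins_if_maker_forces:
  assumes "maker_forces X F {} {}"
  shows "maker_wins X F"
proof -
  define won_by where "won_by M \<longleftrightarrow> (\<exists>W\<in>F. W \<subseteq> M)" for M
  \<comment> \<open>\<open>S\<close> collects everything claimed by both players, so Breaker owns
    \<open>S - M\<close>. \<open>good\<close> packs the three premises of rule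
    \<open>move\<close>.\<close>
  define good where "good M S x \<longleftrightarrow> x \<in> X - S \<and> (won_by (insert x M) \<or> \<not> X \<subseteq> insert x S) \<and>
      (\<forall>y\<in>X - insert x S. maker_forces X F (insert x M) (insert y (S - M)))" for M S x
  \<comment> \<open>The fallback to an arbitrary free element makes \<open>\<sigma>\<close> legal at
    every incomplete history, without appeal to the invariant \<open>safe\<close>.\<close>
  define \<sigma> where "\<sigma> h = (if \<exists>x. good (maker_claims h) (set h) x
      then SOME x. good (maker_claims h) (set h) x else SOME x. x \<in> X - set h)" for h
  have \<sigma>_good: "good (maker_claims h) (set h) (\<sigma> h)"
    if "good (maker_claims h) (set h) x" for h x
    using that someI[of "good (maker_claims h) (set h)"] by (auto simp: \<sigma>_def)
  have \<sigma>_legal: "\<sigma> h \<in> X - set h" if "partial_play X h" "set h \<noteq> X" for h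
  proof (cases "\<exists>x. good (maker_claims h) (set h) x")
    case True
    then show ?thesis using \<sigma>_good by (auto simp: good_def)
  next
    case False
    have "\<exists>x. x \<in> X - set h" using that by (auto simp: partial_play_def)
    then have "(SOME x. x \<in> X - set h) \<in> X - set h" by (rule someI_ex)
    with False show ?thesis by (simp add: \<sigma>_def)
  qed
  \<comment> \<open>At odd length Breaker is to move, and the invariant keeps what Maker's last move
    guaranteed: every reply leads to a forced position.\<close>
  define safe where "safe h \<longleftrightarrow>
      (if even (length h) then maker_forces X F (maker_claims h) (set h - maker_claims h)
       else (won_by (maker_claims h) \<or> \<not> X \<subseteq> set h) \<and>
         (\<forall>y\<in>X - set h. maker_forces X F (maker_claims h) (insert y (set h - maker_claims h))))" for h
  have safe: "safe h" if "partial_play X h" "follows_strategy \<sigma> h" for h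
    using that
  proof (induction h rule: rev_induct)
    case Nil
    then show ?case using assms by (simp add: safe_def maker_claims_def)
  next
    case (snoc x h)
    have x: "x \<in> X" "x \<notin> set h" using snoc.prems by (auto simp: partial_play_def)
    have IH: "safe h"
      using snoc by (simp add: partial_play_def follows_strategy_snoc)
    have sub: "maker_claims h \<subseteq> set h" by (rule maker_claims_subset)
    show ?case
    proof (cases "even (length h)")
      case False
      have "set (h @ [x]) - maker_claims h = insert x (set h - maker_claims h)"
        using sub x by auto
      then show ?thesis using IH False x by (simp add: safe_def maker_claims_snoc)
    next
      case True
      then have "maker_forces X F (maker_claims h) (set h - maker_claims h)"
        using IH by (simp add: safe_def)
      then have "won_by (maker_claims h) \<or> good (maker_claims h) (set h) x"
      proof cases
        case (won W)
        then show ?thesis by (auto simp: won_by_def)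
      next
        case (move z)
        then have "good (maker_claims h) (set h) z"
          using sub by (simp add: good_def won_by_def Un_absorb1)
        then have "good (maker_claims h) (set h) (\<sigma> h)" by (rule \<sigma>_good)
        then show ?thesis using snoc.prems True by (simp add: follows_strategy_snoc)
      qed
      moreover have "insert x (set h) - insert x (maker_claims h) = set h - maker_claims h"
        using x by auto
      moreover have "maker_forces X F (insert x M) S" if "won_by M" for M S
        using that by (auto simp: won_by_def intro: maker_forces.won[of _ F "insert x M"])
      moreover have "won_by (insert x M)" if "won_by M" for M
        using that by (auto simp: won_by_def)
      ultimately show ?thesis using True
        by (simp add: safe_def maker_claims_snoc good_def) blast
    qed
  qed
  \<comment> \<open>On an exhausted board of even length rule \<open>move\<close> has no free
    element, leaving \<open>won\<close>; at odd length \<open>\<not> X \<subseteq> set h\<close>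
    fails, leaving \<open>won_by\<close>.\<close>
  have "\<exists>W\<in>F. W \<subseteq> maker_claims h"
    if "partial_play X h" "set h = X" "follows_strategy \<sigma> h" for h
  proof (cases "even (length h)")
    case True
    then have "maker_forces X F (maker_claims h) (X - maker_claims h)"
      using safe that by (auto simp: safe_def)
    then show ?thesis by cases auto
  next
    case False
    then show ?thesis using safe[OF that(1,3)] that(2) by (simp add: safe_def won_by_def)
  qed
  then have "winning_maker_strategy X F \<sigma>"
    using \<sigma>_legal by (auto simp: winning_maker_strategy_def legal_maker_strategy_def)
  then show ?thesis by (auto simp: maker_wins_def)
qed

section \<open>The seven-vertex pattern\<close>

lemma ex_in_avoiding_two:
  assumes "3 \<le> card S"
  shows "\<exists>s\<in>S. s \<noteq> x \<and> s \<noteq> y"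
proof (rule ccontr)
  assume "\<not> ?thesis"
  then have "S \<subseteq> {x, y}" by auto
  then have "card S \<le> card {x, y}" by (intro card_mono) auto
  also have "\<dots> \<le> 2" by (simp add: card_insert_if)
  finally show False using assms by simp
qed

lemma maker_wins_triangle_game_if_pattern:
  assumes card: "3 \<le> card A" "3 \<le> card B"
    and disj: "v \<notin> A" "v \<notin> B" "A \<inter> B = {}"
    and edges: "{v} \<times> A \<subseteq> T" "A \<times> B \<subseteq> T" "B \<times> {v} \<subseteq> T"
  shows "maker_wins_triangle_game T"
proof -
  let ?F = "triangle_edge_sets T"
  obtain a where a: "a \<in> A" using ex_in_avoiding_two[OF card(1)] by blast
  have triangle: "{(v, c), (c, b), (b, v)} \<in> ?F" if "c \<in> A" "b \<in> B" for b c
    unfolding triangle_edge_sets_def directed_triangle_def using that disj edges by blast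
  have "maker_forces T ?F {} {}"
  proof (rule move[of "(v, a)"])
    show "(v, a) \<in> T - ({} \<union> {})" using a edges by auto
    \<comment> \<open>The free edge \<open>(v, c)\<close> shows that the board is not
      exhausted.\<close>
    obtain c where "c \<in> A" "c \<noteq> a" using ex_in_avoiding_two[OF card(1)] by blast
    then show "(\<exists>W\<in>?F. W \<subseteq> {(v, a)}) \<or> \<not> T \<subseteq> insert (v, a) ({} \<union> {})"
      using edges by auto
  next
    fix y1 assume y1: "y1 \<in> T - insert (v, a) ({} \<union> {})"
    \<comment> \<open>Avoiding \<open>snd y1\<close> ensures that Breaker has not taken
      \<open>(v, a')\<close>.\<close>
    obtain a' where a': "a' \<in> A" "a' \<noteq> a" "a' \<noteq> snd y1"
      using ex_in_avoiding_two[OF card(1)] by blast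
    \<comment> \<open>The only \<open>b\<close> in \<open>B\<close> for which \<open>e\<close> can
      be \<open>(b, v)\<close> or some \<open>(c, b)\<close>: the tail if \<open>e\<close> enters
      \<open>v\<close>, otherwise the head.\<close>
    define touched where "touched e = (if snd e = v then fst e else snd e)" for e
    have touched: "touched (b, v) = b" "touched (c, b) = b" if "b \<in> B" for b c
      using that disj by (auto simp: touched_def)
    show "maker_forces T ?F {(v, a)} {y1}"
    proof (rule move[of "(v, a')"])
      show "(v, a') \<in> T - ({(v, a)} \<union> {y1})" using a' edges by auto
      obtain b where b: "b \<in> B" "b \<noteq> touched y1"
        using ex_in_avoiding_two[OF card(2)] by blast
      then have "(b, v) \<in> T - insert (v, a') ({(v, a)} \<union> {y1})"
        using edges disj touched(1) by auto
      then show "(\<exists>W\<in>?F. W \<subseteq> {(v, a'), (v, a)}) \<or>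
          \<not> T \<subseteq> insert (v, a') ({(v, a)} \<union> {y1})" by blast
    next
      fix y2 assume y2: "y2 \<in> T - insert (v, a') ({(v, a)} \<union> {y1})"
      obtain b where b: "b \<in> B" "b \<noteq> touched y1" "b \<noteq> touched y2"
        using ex_in_avoiding_two[OF card(2)] by blast
      have free: "(b, v) \<notin> {y1, y2}" "(c, b) \<notin> {y1, y2}" for c
        using b touched by auto
      have ne: "b \<noteq> v" "c \<noteq> v" "c \<noteq> b" if "c \<in> A" for c
        using b that disj by auto
      show "maker_forces T ?F {(v, a'), (v, a)} {y2, y1}"
      proof (rule move[of "(b, v)"])
        show "(b, v) \<in> T - ({(v, a'), (v, a)} \<union> {y2, y1})"
          using b edges ne a free by auto
        have "(a, b) \<in> T - insert (b, v) ({(v, a'), (v, a)} \<union> {y2, y1})"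
          using a b edges ne free by auto
        then show "(\<exists>W\<in>?F. W \<subseteq> {(b, v), (v, a'), (v, a)}) \<or>
            \<not> T \<subseteq> insert (b, v) ({(v, a'), (v, a)} \<union> {y2, y1})" by blast
      next
        fix y3 assume y3: "y3 \<in> T - insert (b, v) ({(v, a'), (v, a)} \<union> {y2, y1})"
        \<comment> \<open>The double threat: \<open>y3\<close> cannot be both \<open>(a, b)\<close>
          and \<open>(a', b)\<close>.\<close>
        obtain c where c: "c \<in> {a, a'}" "(c, b) \<noteq> y3" using a'(2) by auto
        have cA: "c \<in> A" using c a a' by auto
        show "maker_forces T ?F {(b, v), (v, a'), (v, a)} {y3, y2, y1}"
        proof (rule maker_forces_finish[OF _ triangle[OF cA b(1)], of "(c, b)"])
          show "(c, b) \<in> T - ({(b, v), (v, a'), (v, a)} \<union> {y3, y2, y1})"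
            using cA b edges ne c free by auto
        qed (use c in auto)
      qed
    qed
  qed
  then show ?thesis
    unfolding maker_wins_triangle_game_def by (rule maker_wins_if_maker_forces)
qed

section \<open>The pattern in the random tournament\<close>

lemma prob_Pi_pmf_agree:
  assumes "finite A" "D \<subseteq> A"
  shows "measure_pmf.prob (Pi_pmf A d q) {f. \<forall>e\<in>D. f e = g e} = (\<Prod>e\<in>D. pmf (q e) (g e))"
proof -
  have "{f. \<forall>e\<in>D. f e = g e} = Pi A (\<lambda>e. if e \<in> D then {g e} else UNIV)"
    using assms by (auto simp: Pi_def split: if_splits)
  also have "measure_pmf.prob (Pi_pmf A d q) \<dots> =
      (\<Prod>e\<in>A. if e \<in> D then pmf (q e) (g e) else 1)"
    using assms by (subst measure_Pi_pmf_Pi) (auto intro!: prod.cong simp: measure_pmf_single)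
  also have "\<dots> = (\<Prod>e\<in>D. pmf (q e) (g e))"
    using assms by (simp add: prod.If_cases Int_absorb1)
  finally show ?thesis .
qed

text \<open>Disagreement on \<open>D k\<close> depends only on the coordinates in
  \<open>D k\<close>; these sets are disjoint, so the events are independent and the probabilities
  of the complements multiply.\<close>

lemma prob_Pi_pmf_no_agreement:
  assumes "finite A" "finite I" "disjoint_family_on D I" "\<And>k. k \<in> I \<Longrightarrow> D k \<subseteq> A"
  shows "measure_pmf.prob (Pi_pmf A d q) {f. \<forall>k\<in>I. \<exists>e\<in>D k. f e \<noteq> g k e} =
    (\<Prod>k\<in>I. 1 - (\<Prod>e\<in>D k. pmf (q e) (g k e)))"
proof (cases "I = {}")
  case False
  let ?P = "measure_pmf (Pi_pmf A d q)"
  let ?M = "\<lambda>k. PiM (D k) (\<lambda>_. count_space UNIV)"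
  let ?R = "\<lambda>k f. restrict f (D k)"
  \<comment> \<open>Disagreement seen on \<open>D k\<close> alone: everything but the single
    restricted function equal to \<open>g k\<close> there.\<close>
  let ?E = "\<lambda>k. space (?M k) - (\<Pi>\<^sub>E e\<in>D k. {g k e})"
  have "prob_space.indep_vars ?P (\<lambda>_. count_space UNIV) (\<lambda>x f. f x) A"
    using assms(1) by (rule indep_vars_Pi_pmf)
  from prob_space.indep_vars_restrict[OF prob_space_measure_pmf this assms(4,3)]
  have indep: "prob_space.indep_vars ?P ?M ?R I" by simp
  have meas: "?E k \<in> sets (?M k)" if "k \<in> I" for k
    using assms(1,4) that by (intro sets.compl_sets sets_PiM_I_finite) (auto intro: finite_subset)
  have vimage: "?R k -` ?E k \<inter> space ?P = UNIV - {f. \<forall>e\<in>D k. f e = g k e}" for k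
    by (auto simp: space_PiM PiE_def Pi_def extensional_def fun_eq_iff)
  have "{f. \<forall>k\<in>I. \<exists>e\<in>D k. f e \<noteq> g k e} = (\<Inter>k\<in>I. ?R k -` ?E k \<inter> space ?P)"
    unfolding vimage by auto
  also have "measure_pmf.prob (Pi_pmf A d q) \<dots> =
      (\<Prod>k\<in>I. measure_pmf.prob (Pi_pmf A d q) (?R k -` ?E k \<inter> space ?P))"
    by (rule prob_space.indep_varsD_finite[OF prob_space_measure_pmf indep False assms(2) meas])
  also have "\<dots> = (\<Prod>k\<in>I. 1 - (\<Prod>e\<in>D k. pmf (q e) (g k e)))"
  proof (rule prod.cong[OF refl])
    fix k assume "k \<in> I"
    then show "measure_pmf.prob (Pi_pmf A d q) (?R k -` ?E k \<inter> space ?P) =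
        1 - (\<Prod>e\<in>D k. pmf (q e) (g k e))"
      unfolding vimage
      using measure_pmf.prob_compl[of "{f. \<forall>e\<in>D k. f e = g k e}" "Pi_pmf A d q"] assms(1,4)
      by (simp add: prob_Pi_pmf_agree)
  qed
  finally show ?thesis .
qed simp

text \<open>Vertices are numbered from 1, so block \<open>k\<close> consists of
  \<open>7 * k + 1\<close> to \<open>7 * k + 7\<close>.\<close>

definition block_pairs :: "nat \<Rightarrow> (nat \<times> nat) set" where
  "block_pairs k = {(i, j). 7 * k < i \<and> i < j \<and> j \<le> 7 * k + 7}"

text \<open>The pattern with \<open>v = 7 k + 1\<close>, followed by the three vertices of \<open>A\<close> and the three of
  \<open>B\<close>: only the edges between \<open>v\<close> and \<open>B\<close> point backwards.\<close>

definition block_pattern :: "nat \<Rightarrow> nat \<times> nat \<Rightarrow> bool" where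
  "block_pattern k = (\<lambda>(i, j). \<not> (i = 7 * k + 1 \<and> 7 * k + 5 \<le> j))"

lemma maker_wins_orient_if_block_pattern:
  assumes "7 * k + 7 \<le> n" and f: "\<And>e. e \<in> block_pairs k \<Longrightarrow> f e = block_pattern k e"
  shows "maker_wins_triangle_game (orient n f)"
proof (rule maker_wins_triangle_game_if_pattern)
  let ?v = "7 * k + 1" and ?A = "{7 * k + 2..7 * k + 4}" and ?B = "{7 * k + 5..7 * k + 7}"
  show "3 \<le> card ?A" "3 \<le> card ?B" "?v \<notin> ?A" "?v \<notin> ?B" "?A \<inter> ?B = {}" by auto
  show "{?v} \<times> ?A \<subseteq> orient n f" "?A \<times> ?B \<subseteq> orient n f" "?B \<times> {?v} \<subseteq> orient n f"
    using assms(1) f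
    by (auto simp: orient_def vertex_pairs_def block_pairs_def block_pattern_def)
qed

text \<open>A crude count by the full square of 7 * 7 pairs; any bound uniform in \<open>k\<close>
  serves.\<close>

lemma card_block_pairs_le: "card (block_pairs k) \<le> 49"
proof -
  have "card (block_pairs k) \<le> card ({7 * k<..7 * k + 7} \<times> {7 * k<..7 * k + 7})"
    by (intro card_mono) (auto simp: block_pairs_def)
  then show ?thesis by simp
qed

lemma prob_maker_loses_le:
  fixes p :: real
  assumes "0 < p" "p < 1"
  shows "measure_pmf.prob (random_tournament n p) {T. \<not> maker_wins_triangle_game T} \<le>
    (1 - min p (1 - p) ^ 49) ^ (n div 7)"
proof -
  let ?P = "Pi_pmf (vertex_pairs n) False (\<lambda>_. bernoulli_pmf p)"
  let ?m = "min p (1 - p)" and ?I = "{..<n div 7}"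
  let ?q = "\<lambda>k. \<Prod>e\<in>block_pairs k. pmf (bernoulli_pmf p) (block_pattern k e)"
  have block: "7 * k + 7 \<le> n" if "k \<in> ?I" for k
    using that by simp
  have sub: "block_pairs k \<subseteq> vertex_pairs n" if "k \<in> ?I" for k
    using block[OF that] by (auto simp: block_pairs_def vertex_pairs_def)
  have disj: "disjoint_family_on block_pairs ?I"
    by (auto simp: disjoint_family_on_def block_pairs_def)
  \<comment> \<open>Each prescribed coin value has probability at least \<open>?m\<close>, and there
    are at most 49 coins.\<close>
  have q_ge: "?m ^ 49 \<le> ?q k" for k
  proof -
    have "?m ^ 49 \<le> ?m ^ card (block_pairs k)"
      using assms by (intro power_decreasing card_block_pairs_le) auto
    also have "\<dots> = (\<Prod>e\<in>block_pairs k. ?m)" by simp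
    also have "\<dots> \<le> ?q k"
    proof (rule prod_mono)
      fix e
      show "0 \<le> ?m \<and> ?m \<le> pmf (bernoulli_pmf p) (block_pattern k e)"
        using assms by (cases "block_pattern k e") auto
    qed
    finally show ?thesis .
  qed
  have "measure_pmf.prob (random_tournament n p) {T. \<not> maker_wins_triangle_game T} =
      measure_pmf.prob ?P {f. \<not> maker_wins_triangle_game (orient n f)}"
    by (simp add: random_tournament_def vimage_def)
  \<comment> \<open>If Maker loses, every block misses its pattern.\<close>
  also have "\<dots> \<le> measure_pmf.prob ?P {f. \<forall>k\<in>?I. \<exists>e\<in>block_pairs k. f e \<noteq> block_pattern k e}"
    using block maker_wins_orient_if_block_pattern
    by (intro measure_pmf.finite_measure_mono) (simp, blast, simp)
  also have "\<dots> = (\<Prod>k\<in>?I. 1 - ?q k)"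
    using sub disj by (intro prob_Pi_pmf_no_agreement finite_vertex_pairs) auto
  also have "\<dots> \<le> (\<Prod>k\<in>?I. 1 - ?m ^ 49)"
    using q_ge by (intro prod_mono) (auto intro!: prod_le_1 simp: pmf_le_1)
  finally show ?thesis by simp
qed

theorem theorem2p3:
  fixes p :: real
  assumes "0 < p" and "p < 1"
  shows "(\<lambda>n. measure_pmf.prob (random_tournament n p) {T. maker_wins_triangle_game T})
           \<longlonglongrightarrow> 1"
proof (rule tendsto_sandwich[where h = "\<lambda>_. 1"])
  let ?r = "1 - min p (1 - p) ^ 49"
  let ?W = "{T. maker_wins_triangle_game T}"
  have "1 - ?r ^ (n div 7) \<le> measure_pmf.prob (random_tournament n p) ?W" for n
  proof -
    have "{T. \<not> maker_wins_triangle_game T} = space (random_tournament n p) - ?W" by auto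
    then have "measure_pmf.prob (random_tournament n p) {T. \<not> maker_wins_triangle_game T} =
        1 - measure_pmf.prob (random_tournament n p) ?W"
      by (simp only: measure_pmf.prob_compl sets_measure_pmf UNIV_I Pow_UNIV sets_count_space)
    then show ?thesis using prob_maker_loses_le[OF assms, of n] by linarith
  qed
  then show "\<forall>\<^sub>F n in sequentially.
      1 - ?r ^ (n div 7) \<le> measure_pmf.prob (random_tournament n p) ?W" by simp
  \<comment> \<open>These bounds place \<open>?r\<close> in [0, 1), so its powers vanish.\<close>
  have "min p (1 - p) ^ 49 \<le> 1" "0 < min p (1 - p) ^ 49"
    using assms by (auto intro!: power_le_one)
  then have "(\<lambda>n. ?r ^ n) \<longlonglongrightarrow> 0" by (intro LIMSEQ_power_zero) auto
  then have "(\<lambda>n. ?r ^ (n div 7)) \<longlonglongrightarrow> 0"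
    by (rule filterlim_compose) (rule filterlim_at_top_div_const_nat, simp)
  then show "(\<lambda>n. 1 - ?r ^ (n div 7)) \<longlonglongrightarrow> 1"
    using tendsto_diff[OF tendsto_const, of _ 0 sequentially 1] by simp
qed auto

end
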